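(* The hypergraph $S_6^{12}$ with vertex set $V_6^{12}=\{v_1,\dots,v_{12}\}$ and the explicitly listed hyperedge set $E_6^{12}$ (given in the context) is a Steiner system $S(5,6,12)$: every hyperedge has exactly $6$ vertices, and every $5$-element subset of $V_6^{12}$ is contained in exactly one hyperedge. Moreover, $E_6^{12}$ consists of exactly $132$ hyperedges.
   Context: A Steiner system $S(t,k,n)$ is a set $V$ of $n$ points together with a collection of $k$-element subsets of $V$ (blocks) such that every $t$-element subset of $V$ is contained in exactly one block. It is regarded as a $k$-uniform hypergraph whose hyperedges are the blocks. Definition of $E_6^{12}$. The complementary hyperedge of a $6$-subset $e\subset V_6^{12}$ is $V_6^{12}\setminus e$. The set $E_6^{12}$ consists of all the $6$-subsets in (1)-(4) below together with the complementary hyperedge of each of them. (1) $\{v_1,v_2,v_3,v_4,v_5,v_6\}$. (2) All sets $A\cup p$ with $p\in B$, where $(A,B)$ is one of the ten pairs: $A=\{v_1,v_2,v_3,v_4\}$, $B=\{\{v_7,v_8\},\{v_9,v_{10}\},\{v_{11},v_{12}\}\}$; $A=\{v_1,v_2,v_3,v_5\}$, $B=\{\{v_7,v_9\},\{v_8,v_{11}\},\{v_{10},v_{12}\}\}$; $A=\{v_1,v_2,v_3,v_6\}$, $B=\{\{v_7,v_{12}\},\{v_8,v_{10}\},\{v_9,v_{11}\}\}$; $A=\{v_1,v_2,v_4,v_5\}$, $B=\{\{v_7,v_{11}\},\{v_8,v_{10}\},\{v_9,v_{12}\}\}$; $A=\{v_1,v_3,v_4,v_5\}$, $B=\{\{v_7,v_{12}\},\{v_8,v_9\},\{v_{10},v_{11}\}\}$;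 $A=\{v_1,v_2,v_4,v_6\}$, $B=\{\{v_7,v_9\},\{v_8,v_{12}\},\{v_{10},v_{11}\}\}$; $A=\{v_1,v_2,v_5,v_6\}$, $B=\{\{v_7,v_{10}\},\{v_8,v_9\},\{v_{11},v_{12}\}\}$; $A=\{v_1,v_3,v_4,v_6\}$, $B=\{\{v_7,v_{10}\},\{v_8,v_{11}\},\{v_9,v_{12}\}\}$; $A=\{v_1,v_3,v_5,v_6\}$, $B=\{\{v_7,v_{11}\},\{v_9,v_{10}\},\{v_8,v_{12}\}\}$; $A=\{v_1,v_4,v_5,v_6\}$, $B=\{\{v_7,v_8\},\{v_9,v_{11}\},\{v_{10},v_{12}\}\}$. (3) All sets $A\cup q$ with $q\in B$, where $(A,B)$ is one of the ten pairs: $A=\{v_1,v_2,v_3\}$, $B=\{\{v_7,v_{10},v_{11}\},\{v_8,v_9,v_{12}\}\}$; $A=\{v_1,v_2,v_4\}$, $B=\{\{v_7,v_{10},v_{12}\},\{v_8,v_9,v_{11}\}\}$; $A=\{v_1,v_2,v_5\}$, $B=\{\{v_7,v_8,v_{12}\},\{v_9,v_{10},v_{11}\}\}$; $A=\{v_1,v_2,v_6\}$, $B=\{\{v_7,v_8,v_{11}\},\{v_9,v_{10},v_{12}\}\}$; $A=\{v_1,v_3,v_4\}$, $B=\{\{v_7,v_9,v_{11}\},\{v_8,v_{10},v_{12}\}\}$; $A=\{v_1,v_3,v_5\}$, $B=\{\{v_7,v_8,v_{10}\},\{v_9,v_{11},v_{12}\}\}$; $A=\{v_1,v_3,v_6\}$,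 $B=\{\{v_7,v_8,v_9\},\{v_{10},v_{11},v_{12}\}\}$; $A=\{v_1,v_4,v_5\}$, $B=\{\{v_7,v_9,v_{10}\},\{v_8,v_{11},v_{12}\}\}$; $A=\{v_1,v_4,v_6\}$, $B=\{\{v_7,v_{11},v_{12}\},\{v_8,v_9,v_{10}\}\}$; $A=\{v_1,v_5,v_6\}$, $B=\{\{v_7,v_9,v_{12}\},\{v_8,v_{10},v_{11}\}\}$. (4) All sets $A\cup r$ with $r\in B$, where $(A,B)$ is one of the five pairs: $A=\{v_1,v_2\}$, $B=\{\{v_7,v_8,v_9,v_{10}\},\{v_7,v_9,v_{11},v_{12}\},\{v_8,v_{10},v_{11},v_{12}\}\}$; $A=\{v_1,v_3\}$, $B=\{\{v_7,v_8,v_{11},v_{12}\},\{v_8,v_9,v_{10},v_{11}\},\{v_7,v_9,v_{10},v_{12}\}\}$; $A=\{v_1,v_4\}$, $B=\{\{v_7,v_8,v_9,v_{12}\},\{v_7,v_8,v_{10},v_{11}\},\{v_9,v_{10},v_{11},v_{12}\}\}$; $A=\{v_1,v_5\}$, $B=\{\{v_7,v_8,v_9,v_{11}\},\{v_8,v_9,v_{10},v_{12}\},\{v_7,v_{10},v_{11},v_{12}\}\}$; $A=\{v_1,v_6\}$, $B=\{\{v_7,v_8,v_{10},v_{12}\},\{v_7,v_9,v_{10},v_{11}\},\{v_8,v_9,v_{11},v_{12}\}\}$. *)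

theory Defs
  imports Main
begin

definition steiner_system :: "nat \<Rightarrow> nat \<Rightarrow> nat \<Rightarrow> 'a set \<Rightarrow> 'a set set \<Rightarrow> bool" where
  "steiner_system t k n V E \<longleftrightarrow>
     finite V \<and> card V = n \<and>
     (\<forall>e\<in>E. e \<subseteq> V \<and> card e = k) \<and>
     (\<forall>T. T \<subseteq> V \<and> card T = t \<longrightarrow> (\<exists>!e. e \<in> E \<and> T \<subseteq> e))"

text \<open>The vertex \<open>v\<^sub>i\<close> is represented by the natural number \<open>i\<close>.\<close>

definition V_6_12 :: "nat set" where
  "V_6_12 = {1..12}"

definition pairs2 :: "(nat set \<times> nat set set) set" where
  "pairs2 =
    {({1,2,3,4}, {{7,8}, {9,10}, {11,12}}),
     ({1,2,3,5}, {{7,9}, {8,11}, {10,12}}),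
     ({1,2,3,6}, {{7,12}, {8,10}, {9,11}}),
     ({1,2,4,5}, {{7,11}, {8,10}, {9,12}}),
     ({1,3,4,5}, {{7,12}, {8,9}, {10,11}}),
     ({1,2,4,6}, {{7,9}, {8,12}, {10,11}}),
     ({1,2,5,6}, {{7,10}, {8,9}, {11,12}}),
     ({1,3,4,6}, {{7,10}, {8,11}, {9,12}}),
     ({1,3,5,6}, {{7,11}, {9,10}, {8,12}}),
     ({1,4,5,6}, {{7,8}, {9,11}, {10,12}})}"

definition pairs3 :: "(nat set \<times> nat set set) set" where
  "pairs3 =
    {({1,2,3}, {{7,10,11}, {8,9,12}}),
     ({1,2,4}, {{7,10,12}, {8,9,11}}),
     ({1,2,5}, {{7,8,12}, {9,10,11}}),
     ({1,2,6}, {{7,8,11}, {9,10,12}}),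
     ({1,3,4}, {{7,9,11}, {8,10,12}}),
     ({1,3,5}, {{7,8,10}, {9,11,12}}),
     ({1,3,6}, {{7,8,9}, {10,11,12}}),
     ({1,4,5}, {{7,9,10}, {8,11,12}}),
     ({1,4,6}, {{7,11,12}, {8,9,10}}),
     ({1,5,6}, {{7,9,12}, {8,10,11}})}"

definition pairs4 :: "(nat set \<times> nat set set) set" where
  "pairs4 =
    {({1,2}, {{7,8,9,10}, {7,9,11,12}, {8,10,11,12}}),
     ({1,3}, {{7,8,11,12}, {8,9,10,11}, {7,9,10,12}}),
     ({1,4}, {{7,8,9,12}, {7,8,10,11}, {9,10,11,12}}),
     ({1,5}, {{7,8,9,11}, {8,9,10,12}, {7,10,11,12}}),
     ({1,6}, {{7,8,10,12}, {7,9,10,11}, {8,9,11,12}})}"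

definition listed_hyperedges :: "nat set set" where
  "listed_hyperedges =
     {{1,2,3,4,5,6}} \<union>
     {A \<union> p | A B p. (A, B) \<in> pairs2 \<and> p \<in> B} \<union>
     {A \<union> q | A B q. (A, B) \<in> pairs3 \<and> q \<in> B} \<union>
     {A \<union> r | A B r. (A, B) \<in> pairs4 \<and> r \<in> B}"

definition E_6_12 :: "nat set set" where
  "E_6_12 = listed_hyperedges \<union> {V_6_12 - e | e. e \<in> listed_hyperedges}"

end

theory Submission
  imports Defs
begin

text \<open>
  Each block is represented by its increasing list of points, so that distinct lists denote
  distinct blocks. The Steiner property is then a finite computation: a point set is built up
  one point at a time while the blocks that do not contain it are discarded, and after five
  points exactly one block is left.
\<close>

fun unique_extension :: "nat \<Rightarrow> nat \<Rightarrow> bool list list \<Rightarrow> bool" where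
  "unique_extension 0 n bs \<longleftrightarrow> length bs = 1"
| "unique_extension (Suc t) 0 bs \<longleftrightarrow> True"
| "unique_extension (Suc t) (Suc n) bs \<longleftrightarrow>
     unique_extension t n (map tl (filter hd bs)) \<and> unique_extension (Suc t) n (map tl bs)"

text \<open>Working on incidence vectors keeps comparisons of numerals out of the evaluated recursion.\<close>

definition incidence :: "'a list \<Rightarrow> 'a list list \<Rightarrow> bool list list" where
  "incidence ps bs = map (\<lambda>b. map (\<lambda>p. p \<in> set b) ps) bs"

text \<open>Induction along the recursion, by whether the first point lies in \<open>T\<close>. If
  it does, only blocks through it can contain \<open>T\<close>, and the rest of \<open>T\<close>
  must single out one of them; if not, the point can be forgotten and all blocks stay.\<close>

lemma unique_extension_sound:
  assumes "unique_extension t (length ps) (incidence ps bs)" and "T \<subseteq> set ps" and "card T = t"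
  shows "\<exists>!b. b \<in> set bs \<and> T \<subseteq> set b"
  using assms
proof (induction t "length ps" "incidence ps bs" arbitrary: ps bs T rule: unique_extension.induct)
  case 1
  \<comment> \<open>\<open>card T = 0\<close> also holds for infinite \<open>T\<close>; finiteness
    comes from \<open>T \<subseteq> set ps\<close>.\<close>
  then have "T = {}"
    using finite_subset by fastforce
  with 1 show ?case
    by (auto simp: incidence_def length_Suc_conv)
next
  case 2
  \<comment> \<open>\<open>ps\<close> is empty, so no \<open>T\<close> inside it has
    \<open>Suc t\<close> points; hence the value \<open>True\<close>.\<close>
  then show ?case
    by simp
next
  case (3 t n)
  obtain p ps' where ps: "ps = p # ps'" and n: "n = length ps'"
    using "3.hyps"(3) by (metis length_Suc_conv)
  \<comment> \<open>The head of an incidence vector records membership of \<open>p\<close>, and its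
    tail is the vector over \<open>ps'\<close>.\<close>
  have filtered: "map tl (filter hd (incidence ps bs)) = incidence ps' (filter (\<lambda>b. p \<in> set b) bs)"
    and all: "map tl (incidence ps bs) = incidence ps' bs"
    by (simp_all add: incidence_def ps filter_map o_def)
  have ext: "unique_extension t n (incidence ps' (filter (\<lambda>b. p \<in> set b) bs))"
    "unique_extension (Suc t) n (incidence ps' bs)"
    using "3.prems"(1) filtered all by (simp_all add: ps n)
  show ?case
  proof (cases "p \<in> T")
    case True
    have "card (T - {p}) = t" "T - {p} \<subseteq> set ps'"
      using "3.prems"(2,3) True by (auto simp: ps)
    then have "\<exists>!b. b \<in> set (filter (\<lambda>b. p \<in> set b) bs) \<and> T - {p} \<subseteq> set b"
      using "3.hyps"(1)[OF n filtered] ext(1) by (simp add: n)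
    moreover have "b \<in> set (filter (\<lambda>b. p \<in> set b) bs) \<and> T - {p} \<subseteq> set b \<longleftrightarrow>
        b \<in> set bs \<and> T \<subseteq> set b" for b
      using True by auto
    ultimately show ?thesis
      by simp
  next
    case False
    then have "T \<subseteq> set ps'"
      using "3.prems"(2) by (auto simp: ps)
    then show ?thesis
      using "3.hyps"(2)[OF n all] ext(2) "3.prems"(3) by (simp add: n)
  qed
qed

text \<open>List versions of the tables, made for computation. Points up to 6 come before those from
  7 on, so appending the two parts of a block yields an increasing list.\<close>

definition table2 :: "(nat list \<times> nat list list) list" where
  "table2 =
    [([1,2,3,4], [[7,8], [9,10], [11,12]]),
     ([1,2,3,5], [[7,9], [8,11], [10,12]]),
     ([1,2,3,6], [[7,12], [8,10], [9,11]]),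
     ([1,2,4,5], [[7,11], [8,10], [9,12]]),
     ([1,3,4,5], [[7,12], [8,9], [10,11]]),
     ([1,2,4,6], [[7,9], [8,12], [10,11]]),
     ([1,2,5,6], [[7,10], [8,9], [11,12]]),
     ([1,3,4,6], [[7,10], [8,11], [9,12]]),
     ([1,3,5,6], [[7,11], [9,10], [8,12]]),
     ([1,4,5,6], [[7,8], [9,11], [10,12]])]"

definition table3 :: "(nat list \<times> nat list list) list" where
  "table3 =
    [([1,2,3], [[7,10,11], [8,9,12]]),
     ([1,2,4], [[7,10,12], [8,9,11]]),
     ([1,2,5], [[7,8,12], [9,10,11]]),
     ([1,2,6], [[7,8,11], [9,10,12]]),
     ([1,3,4], [[7,9,11], [8,10,12]]),
     ([1,3,5], [[7,8,10], [9,11,12]]),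
     ([1,3,6], [[7,8,9], [10,11,12]]),
     ([1,4,5], [[7,9,10], [8,11,12]]),
     ([1,4,6], [[7,11,12], [8,9,10]]),
     ([1,5,6], [[7,9,12], [8,10,11]])]"

definition table4 :: "(nat list \<times> nat list list) list" where
  "table4 =
    [([1,2], [[7,8,9,10], [7,9,11,12], [8,10,11,12]]),
     ([1,3], [[7,8,11,12], [8,9,10,11], [7,9,10,12]]),
     ([1,4], [[7,8,9,12], [7,8,10,11], [9,10,11,12]]),
     ([1,5], [[7,8,9,11], [8,9,10,12], [7,10,11,12]]),
     ([1,6], [[7,8,10,12], [7,9,10,11], [8,9,11,12]])]"

definition sets_of_table :: "('a list \<times> 'a list list) list \<Rightarrow> ('a set \<times> 'a set set) set" where
  "sets_of_table tab = (\<lambda>(a, bs). (set a, set ` set bs)) ` set tab"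

lemma pairs_eq_tables:
  "pairs2 = sets_of_table table2"
  "pairs3 = sets_of_table table3"
  "pairs4 = sets_of_table table4"
  by (simp_all only: pairs2_def table2_def pairs3_def table3_def pairs4_def table4_def
      sets_of_table_def list.set image_insert image_empty prod.case)

definition expand :: "('a list \<times> 'a list list) list \<Rightarrow> 'a list list" where
  "expand tab = concat (map (\<lambda>(a, bs). map ((@) a) bs) tab)"

lemma expand_sets:
  "{A \<union> p | A B p. (A, B) \<in> sets_of_table tab \<and> p \<in> B} = set ` set (expand tab)"
proof -
  have "{A \<union> p | A B p. (A, B) \<in> sets_of_table tab \<and> p \<in> B} =
      (\<Union>(A, B) \<in> sets_of_table tab. (\<union>) A ` B)"
    by blast
  also have "\<dots> = set ` set (expand tab)"
    by (simp add: sets_of_table_def expand_def image_UN image_image case_prod_beta)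
  finally show ?thesis .
qed

definition half_blocks :: "nat list list" where
  "half_blocks = [1,2,3,4,5,6] # expand table2 @ expand table3 @ expand table4"

lemma listed_hyperedges_eq: "listed_hyperedges = set ` set half_blocks"
  by (simp add: listed_hyperedges_def pairs_eq_tables expand_sets half_blocks_def image_Un Un_assoc)

text \<open>Filtering the ordered list of the points 1 to 12 leaves an increasing list, so
  complements are again in canonical form.\<close>

definition complement_block :: "nat list \<Rightarrow> nat list" where
  "complement_block b = filter (\<lambda>x. x \<notin> set b) [1..<13]"

lemma set_complement_block: "set (complement_block b) = V_6_12 - set b"
  by (auto simp: complement_block_def V_6_12_def)

definition blocks :: "nat list list" where
  "blocks = half_blocks @ map complement_block half_blocks"

lemma E_6_12_eq: "E_6_12 = set ` set blocks"
  by (simp add: E_6_12_def listed_hyperedges_eq blocks_def image_Un image_image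
      set_complement_block Setcompr_eq_image)

text \<open>The half list has 1 + 30 + 20 + 15 = 66 entries, and the complements double this.
  Distinctness also shows that no complement is already listed.\<close>

lemma blocks_valid:
  "length blocks = 132 \<and> distinct blocks \<and>
   list_all (\<lambda>b. sorted_wrt (<) b \<and> length b = 6 \<and> list_all (\<lambda>x. 1 \<le> x \<and> x \<le> 12) b) blocks"
  by (simp add: blocks_def half_blocks_def expand_def table2_def table3_def table4_def
      complement_block_def upt_rec)

text \<open>The recursion reaches each of the 792 five-point subsets of the twelve points; subsets
  with a common initial choice share the filtering.\<close>

lemma blocks_unique_extension: "unique_extension 5 12 (incidence [1..<13] blocks)"
  by code_simp

text \<open>A strictly increasing list is determined by its set, so counting lists counts
  blocks.\<close>

lemma inj_on_set_blocks: "inj_on set (set blocks)"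
  using blocks_valid by (auto simp: inj_on_def list_all_iff intro: strict_sorted_equal)

theorem mainTheorem1:
  shows "steiner_system 5 6 12 V_6_12 E_6_12 \<and> card E_6_12 = 132"
proof
  have "\<exists>!e. e \<in> E_6_12 \<and> T \<subseteq> e" if "T \<subseteq> V_6_12" "card T = 5" for T
  proof -
    have "\<exists>!b. b \<in> set blocks \<and> T \<subseteq> set b"
    proof (rule unique_extension_sound)
      show "unique_extension 5 (length [1..<13]) (incidence [1..<13] blocks)"
        using blocks_unique_extension by simp
      show "T \<subseteq> set [1..<13]"
        using that(1) by (auto simp: V_6_12_def)
    qed (fact that(2))
    then show ?thesis
      unfolding E_6_12_eq by blast
  qed
  moreover have "e \<subseteq> V_6_12 \<and> card e = 6" if "e \<in> E_6_12" for e
    \<comment> \<open>Strict sortedness gives distinctness, so the length 6 is the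
      cardinality.\<close>
    using that blocks_valid
    by (auto simp: E_6_12_eq V_6_12_def list_all_iff strict_sorted_iff distinct_card)
  ultimately show "steiner_system 5 6 12 V_6_12 E_6_12"
    by (simp add: steiner_system_def V_6_12_def)
  show "card E_6_12 = 132"
    using blocks_valid by (simp add: E_6_12_eq card_image[OF inj_on_set_blocks] distinct_card)
qed

end
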